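(* Let $\alpha,\beta,\gamma,\delta,r,\sigma,\kappa,\mu,\mathcal C,\mathcal A$ be real constants with $\beta>0$, $\gamma\neq0$, $\sigma\neq0$, $\mathcal A>0$, let $$\Delta_2=\exp\left(\frac{\gamma(2-4\delta)+(1+2\mathcal C)^2-4\gamma\log\beta}{4\gamma}\right),$$ and let $$f(\zeta)=-\frac{\gamma}{\beta}(\alpha+\beta\zeta)\left(\delta+\log|\alpha+\beta\zeta|\right).$$ Then the function $$u(x,t)=\Delta_2\, e^{E(x,t)}\,|x|^{\gamma\left(\frac12-\frac{r}{\sigma^2}\right)t+\frac{1+2\mathcal C}{\sqrt2\,\sigma}}-\frac{\alpha}{\beta},$$ where $$E(x,t)=\frac{\sigma^2\left(\kappa\sigma-4\sqrt2\,\gamma\mu\,\mathcal C\right)e^{\gamma t}+\gamma(\sigma^2-2r)\left(\sigma\left(\gamma\sigma t+2\sqrt2(1+2\mathcal C)\right)-2r\gamma t\right)t+4\gamma^2\log^2|x|}{8\gamma\sigma^2},$$ is a solution, for $x\neq0$, of the equation $$u_t+\tfrac12\sigma^2x^2u_{xx}+r x u_x+f(u)=0,$$ and it satisfies the barrier condition $u(H(t),t)=R(t)$ for all $t$, where $$H(t)=\mathcal A\,e^{\frac12(2r-\sigma^2)t+\frac12\sigma\mu e^{\gamma t}}$$ and $$R(t)=\Delta_2\exp\left(\frac18\left(\gamma\mu^2e^{2\gamma t}+\frac{e^{\gamma t}\left(2\sqrt2\,\gamma\mu+\kappa\sigma\right)}{\gamma}+\frac{4\gamma\log^2|\mathcal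 A|}{\sigma^2}\right)\right)\mathcal A^{\frac{\gamma\mu e^{\gamma t}+\sqrt2(1+2\mathcal C)}{2\sigma}}-\frac{\alpha}{\beta}.$$
   Context: $u=u(x,t)$ is a real-valued function; subscripts denote partial derivatives; $\log$ is the natural logarithm and $\log^2|x|=(\log|x|)^2$. $H$ is the barrier function and $R$ the rebate function of a (down-and-out) barrier option, and the barrier condition is $u(H(t),t)=R(t)$. *)

theory Defs
  imports "HOL-Analysis.Analysis"
begin

text \<open>
  The equation \<open>u\<^sub>t + \<sigma>\<^sup>2/2 x\<^sup>2 u\<^sub>x\<^sub>x + r x u\<^sub>x + f(u) = 0\<close> in the classical pointwise sense, the
  arguments of \<open>u\<close> being in the order \<open>x\<close>, \<open>t\<close>. Since \<^const>\<open>deriv\<close> is an arbitrary value where a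
  derivative does not exist, the existence of \<open>u\<^sub>t\<close>, \<open>u\<^sub>x\<close> and \<open>u\<^sub>x\<^sub>x\<close> is part of the definition.
\<close>

definition is_solution_on ::
  "real \<Rightarrow> real \<Rightarrow> (real \<Rightarrow> real) \<Rightarrow> (real \<times> real) set \<Rightarrow> (real \<Rightarrow> real \<Rightarrow> real) \<Rightarrow> bool"
where
  "is_solution_on \<sigma> r f D u \<longleftrightarrow>
    (\<forall>(x, t) \<in> D.
       (\<lambda>s. u x s) differentiable (at t) \<and>
       (\<lambda>y. u y t) differentiable (at x) \<and>
       deriv (\<lambda>y. u y t) differentiable (at x) \<and>
       deriv (\<lambda>s. u x s) t
         + 1/2 * \<sigma>^2 * x^2 * deriv (deriv (\<lambda>y. u y t)) x
         + r * x * deriv (\<lambda>y. u y t) x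
         + f (u x t) = 0)"

definition satisfies_barrier_condition ::
  "(real \<Rightarrow> real) \<Rightarrow> (real \<Rightarrow> real) \<Rightarrow> (real \<Rightarrow> real \<Rightarrow> real) \<Rightarrow> bool"
where
  "satisfies_barrier_condition H R u \<longleftrightarrow> (\<forall>t. u (H t) t = R t)"

end

theory Submission imports Defs begin

text \<open>
  Two substitutions turn the equation into a polynomial identity. First, \<open>v = u + \<alpha>/\<beta>\<close> is
  positive, so \<open>v = D e\<^sup>G\<close>, and the nonlinearity becomes \<open>-\<gamma> v (\<delta> + ln (\<beta> D) + G)\<close>: the logarithm
  in \<open>f\<close> is undone by the exponential, and dividing the equation by \<open>v\<close> leaves an equation for \<open>G\<close> that is
  quadratic. Second, the Euler operator \<open>\<sigma>\<^sup>2/2 x\<^sup>2 \<partial>\<^sub>x\<^sup>2 + r x \<partial>\<^sub>x\<close> has constant coefficients in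
  \<open>ln \<bar>x\<bar>\<close>, and its first-order part is absorbed by passing to the moving coordinate
  \<open>y = ln \<bar>x\<bar> - (r - \<sigma>\<^sup>2/2) t\<close>. Together they give
  \<open>G\<^sub>t + \<sigma>\<^sup>2/2 (G\<^sub>y\<^sub>y + G\<^sub>y\<^sup>2) = \<gamma> (\<delta> + ln (\<beta> D) + G)\<close> (lemma \<open>is_solution_on_moving_frame\<close>).

  The solution of the theorem is the Gaussian one: expanding the square shows that its exponent is
  \<open>G = a e\<^sup>\<gamma>\<^sup>t + \<gamma>/(2 \<sigma>\<^sup>2) y\<^sup>2 + d y\<close> with \<open>d = (1 + 2 C)/(\<surd>2 \<sigma>)\<close>
  and \<open>a = (\<kappa> \<sigma> - 4 \<surd>2 \<gamma> \<mu> C)/(8 \<gamma>)\<close> (lemma \<open>exponent_completed_square\<close>). The quadratic term reproduces itself because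
  \<open>\<sigma>\<^sup>2/2 (\<gamma>/\<sigma>\<^sup>2)\<^sup>2 = \<gamma> \<cdot> \<gamma>/(2 \<sigma>\<^sup>2)\<close>, the linear and exponential terms balance likewise, and the
  remaining constants balance exactly when \<open>\<delta> + ln (\<beta> D) = 1/2 + \<sigma>\<^sup>2 d\<^sup>2/(2 \<gamma>)\<close>, which is what
  fixes \<open>\<Delta>2\<close>.

  The barrier is the curve on which \<open>y = ln A + \<sigma> \<mu> e\<^sup>\<gamma>\<^sup>t/2\<close>. There \<open>t\<close> enters \<open>G\<close> only through
  \<open>e\<^sup>\<gamma>\<^sup>t\<close>, and expanding \<open>G\<close> in powers of \<open>e\<^sup>\<gamma>\<^sup>t\<close> gives the rebate.
\<close>

lemma DERIV_ln_abs:
  fixes x :: real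
  assumes "x \<noteq> 0"
  shows "((\<lambda>y. ln \<bar>y\<bar>) has_real_derivative 1 / x) (at x)"
proof (cases "x > 0")
  case True
  have "(ln has_real_derivative 1 / x) (at x)"
    using True by (auto intro!: derivative_eq_intros)
  then show ?thesis
    by (rule has_field_derivative_transform_within_open[of _ _ _ "{0<..}"]) (use True in auto)
next
  case False
  then have "x < 0" using assms by simp
  have "((\<lambda>y. ln (- y)) has_real_derivative 1 / x) (at x)"
    using \<open>x < 0\<close> by (auto intro!: derivative_eq_intros)
  then show ?thesis
    by (rule has_field_derivative_transform_within_open[of _ _ _ "{..<0}"]) (use \<open>x < 0\<close> in auto)
qed

text \<open>
  With \<open>v = D e\<^sup>G\<close> one has \<open>x v\<^sub>x = v G\<^sub>y\<close> and \<open>x\<^sup>2 v\<^sub>x\<^sub>x = v (G\<^sub>y\<^sub>y + G\<^sub>y\<^sup>2 - G\<^sub>y)\<close>, while the motion of the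
  coordinate adds \<open>-(r - \<sigma>\<^sup>2/2) G\<^sub>y\<close> to the time derivative; the multiples of \<open>G\<^sub>y\<close> cancel.
  Since \<open>ln \<bar>x\<bar>\<close> has the derivative \<open>1/x\<close> on both half-lines, no sign of \<open>x\<close> is distinguished.
  The time derivative is taken at fixed \<open>x\<close>, where
  \<open>y\<close> moves, so \<open>G\<close> is required to be differentiable along every line \<open>s \<mapsto> (z - (r - \<sigma>\<^sup>2/2) s, s)\<close>
  and not merely in each argument.
\<close>

lemma is_solution_on_moving_frame:
  fixes \<alpha> \<beta> \<gamma> \<delta> r \<sigma> D :: real
    and G Gt Gy Gyy :: "real \<Rightarrow> real \<Rightarrow> real"
  defines "m \<equiv> r - \<sigma>\<^sup>2 / 2"
  assumes "\<beta> > 0" and "D > 0"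
    and f: "\<And>\<zeta>. f \<zeta> = - (\<gamma> / \<beta>) * (\<alpha> + \<beta> * \<zeta>) * (\<delta> + ln \<bar>\<alpha> + \<beta> * \<zeta>\<bar>)"
    and u: "\<And>x t. x \<noteq> 0 \<Longrightarrow> u x t = D * exp (G (ln \<bar>x\<bar> - m * t) t) - \<alpha> / \<beta>"
    and Gt: "\<And>z t. ((\<lambda>s. G (z - m * s) s) has_real_derivative
                       Gt (z - m * t) t - m * Gy (z - m * t) t) (at t)"
    and Gy: "\<And>y t. ((\<lambda>y. G y t) has_real_derivative Gy y t) (at y)"
    and Gyy: "\<And>y t. ((\<lambda>y. Gy y t) has_real_derivative Gyy y t) (at y)"
    and eq: "\<And>y t. Gt y t + \<sigma>\<^sup>2 / 2 * (Gyy y t + (Gy y t)\<^sup>2) = \<gamma> * (\<delta> + ln (\<beta> * D) + G y t)"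
  shows "is_solution_on \<sigma> r f {(x, t). x \<noteq> 0} u"
proof -
  have "(\<lambda>s. u x s) differentiable (at t) \<and>
        (\<lambda>y. u y t) differentiable (at x) \<and>
        deriv (\<lambda>y. u y t) differentiable (at x) \<and>
        deriv (\<lambda>s. u x s) t + 1/2 * \<sigma>^2 * x^2 * deriv (deriv (\<lambda>y. u y t)) x
          + r * x * deriv (\<lambda>y. u y t) x + f (u x t) = 0"
    if x: "x \<noteq> 0" for x t :: real
  proof -
    define Y where "Y z = ln \<bar>z\<bar> - m * t" for z
    define v where "v z = D * exp (G (Y z) t)" for z
    have Y: "(Y has_real_derivative 1 / z) (at z)" if "z \<noteq> 0" for z
      unfolding Y_def using DERIV_diff[OF DERIV_ln_abs[OF that] DERIV_const[of "m * t"]] by simp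
    have G': "((\<lambda>z. G (Y z) t) has_real_derivative Gy (Y z) t / z) (at z)" if "z \<noteq> 0" for z
      using DERIV_chain2[OF Gy Y[OF that]] by simp
    have Gy': "((\<lambda>z. Gy (Y z) t) has_real_derivative Gyy (Y z) t / z) (at z)" if "z \<noteq> 0" for z
      using DERIV_chain2[OF Gyy Y[OF that]] by simp
    have v': "(v has_real_derivative v z * Gy (Y z) t / z) (at z)" if "z \<noteq> 0" for z
      unfolding v_def using G'[OF that] by (auto intro!: derivative_eq_intros)
    have ut: "((\<lambda>s. u x s) has_real_derivative v x * (Gt (Y x) t - m * Gy (Y x) t)) (at t)"
      unfolding u[OF x] v_def Y_def using Gt[of "ln \<bar>x\<bar>" t]
      by (auto intro!: derivative_eq_intros)
    have ux: "((\<lambda>y. u y t) has_real_derivative v z * Gy (Y z) t / z) (at z)" if "z \<noteq> 0" for z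
    proof -
      have "((\<lambda>y. v y - \<alpha> / \<beta>) has_real_derivative v z * Gy (Y z) t / z) (at z)"
        using v'[OF that] by (auto intro!: derivative_eq_intros)
      then show ?thesis
        by (rule has_field_derivative_transform_within_open[of _ _ _ "- {0}"])
          (use that in \<open>auto simp: u v_def Y_def\<close>)
    qed
    have uxx: "(deriv (\<lambda>y. u y t) has_real_derivative
        v x * (Gyy (Y x) t + (Gy (Y x) t)\<^sup>2 - Gy (Y x) t) / x\<^sup>2) (at x)"
    proof -
      have "((\<lambda>z. v z * Gy (Y z) t / z) has_real_derivative
          v x * (Gyy (Y x) t + (Gy (Y x) t)\<^sup>2 - Gy (Y x) t) / x\<^sup>2) (at x)"
        by (rule derivative_eq_intros v'[OF x] Gy'[OF x] x refl)+
          (use x in \<open>simp add: field_simps power2_eq_square\<close>)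
      then show ?thesis
        by (rule has_field_derivative_transform_within_open[of _ _ _ "- {0}"])
          (use x in \<open>auto simp: DERIV_imp_deriv[OF ux]\<close>)
    qed
    have "v x > 0" using \<open>D > 0\<close> by (simp add: v_def)
    have w: "\<alpha> + \<beta> * u x t = \<beta> * v x"
      using \<open>\<beta> > 0\<close> by (simp add: u[OF x] v_def Y_def field_simps)
    have "ln \<bar>\<beta> * v x\<bar> = ln (\<beta> * D) + G (Y x) t"
      using \<open>\<beta> > 0\<close> \<open>D > 0\<close> by (simp add: v_def ln_mult abs_mult)
    then have fu: "f (u x t) = - v x * (\<gamma> * (\<delta> + ln (\<beta> * D) + G (Y x) t))"
      unfolding f w using \<open>\<beta> > 0\<close> by (simp add: add.assoc)
    have "deriv (\<lambda>s. u x s) t + 1/2 * \<sigma>^2 * x^2 * deriv (deriv (\<lambda>y. u y t)) x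
          + r * x * deriv (\<lambda>y. u y t) x
        = v x * (Gt (Y x) t + \<sigma>\<^sup>2 / 2 * (Gyy (Y x) t + (Gy (Y x) t)\<^sup>2))"
      unfolding DERIV_imp_deriv[OF ut] DERIV_imp_deriv[OF ux[OF x]] DERIV_imp_deriv[OF uxx] m_def
      using x by (simp add: field_simps)
    then have "deriv (\<lambda>s. u x s) t + 1/2 * \<sigma>^2 * x^2 * deriv (deriv (\<lambda>y. u y t)) x
          + r * x * deriv (\<lambda>y. u y t) x + f (u x t) = 0"
      unfolding fu eq by simp
    then show ?thesis
      using ut ux[OF x] uxx by (auto simp: real_differentiable_def)
  qed
  then show ?thesis
    unfolding is_solution_on_def by auto
qed

lemma is_solution_on_gaussian:
  fixes \<alpha> \<beta> \<gamma> \<delta> r \<sigma> D a d :: real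
  assumes "\<beta> > 0" and "\<gamma> \<noteq> 0" and "\<sigma> \<noteq> 0" and "D > 0"
    and D: "\<delta> + ln (\<beta> * D) = 1 / 2 + \<sigma>\<^sup>2 * d\<^sup>2 / (2 * \<gamma>)"
    and f: "\<And>\<zeta>. f \<zeta> = - (\<gamma> / \<beta>) * (\<alpha> + \<beta> * \<zeta>) * (\<delta> + ln \<bar>\<alpha> + \<beta> * \<zeta>\<bar>)"
    and G: "\<And>y t. G y t = a * exp (\<gamma> * t) + \<gamma> / (2 * \<sigma>\<^sup>2) * y\<^sup>2 + d * y"
    and u: "\<And>x t. x \<noteq> 0 \<Longrightarrow> u x t = D * exp (G (ln \<bar>x\<bar> - (r - \<sigma>\<^sup>2 / 2) * t) t) - \<alpha> / \<beta>"
  shows "is_solution_on \<sigma> r f {(x, t). x \<noteq> 0} u"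
proof (rule is_solution_on_moving_frame[where f = f and u = u and G = G and
      Gt = "\<lambda>y t. a * \<gamma> * exp (\<gamma> * t)" and Gy = "\<lambda>y t. \<gamma> / \<sigma>\<^sup>2 * y + d" and Gyy = "\<lambda>y t. \<gamma> / \<sigma>\<^sup>2",
      OF \<open>\<beta> > 0\<close> \<open>D > 0\<close> f u])
  show "((\<lambda>s. G (z - (r - \<sigma>\<^sup>2 / 2) * s) s) has_real_derivative a * \<gamma> * exp (\<gamma> * t)
      - (r - \<sigma>\<^sup>2 / 2) * (\<gamma> / \<sigma>\<^sup>2 * (z - (r - \<sigma>\<^sup>2 / 2) * t) + d)) (at t)" for z t
    unfolding G using \<open>\<sigma> \<noteq> 0\<close>
    by (auto intro!: derivative_eq_intros simp: field_simps)
  show "((\<lambda>y. G y t) has_real_derivative \<gamma> / \<sigma>\<^sup>2 * y + d) (at y)" for y t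
    unfolding G using \<open>\<sigma> \<noteq> 0\<close> by (auto intro!: derivative_eq_intros simp: field_simps)
  show "((\<lambda>y. \<gamma> / \<sigma>\<^sup>2 * y + d) has_real_derivative \<gamma> / \<sigma>\<^sup>2) (at y)" for y :: real
    using DERIV_add[OF DERIV_cmult_Id[of "\<gamma> / \<sigma>\<^sup>2"] DERIV_const[of d]] by simp
  show "a * \<gamma> * exp (\<gamma> * t) + \<sigma>\<^sup>2 / 2 * (\<gamma> / \<sigma>\<^sup>2 + (\<gamma> / \<sigma>\<^sup>2 * y + d)\<^sup>2)
      = \<gamma> * (\<delta> + ln (\<beta> * D) + G y t)" for y t
    unfolding D G using \<open>\<sigma> \<noteq> 0\<close> \<open>\<gamma> \<noteq> 0\<close> by (simp add: field_simps power2_eq_square)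
qed

text \<open>
  The terms of \<open>E\<close> free of \<open>ln \<bar>x\<bar>\<close> and polynomial in \<open>t\<close>, together with the power of \<open>\<bar>x\<bar>\<close>, are
  what the displacement \<open>(r - \<sigma>\<^sup>2/2) t\<close> contributes to the square and to the linear term.
\<close>

lemma exponent_completed_square:
  fixes \<gamma> r \<sigma> \<kappa> \<mu> C L t :: real
  assumes "\<gamma> \<noteq> 0" and "\<sigma> \<noteq> 0"
  shows "(\<sigma>^2 * (\<kappa> * \<sigma> - 4 * sqrt 2 * \<gamma> * \<mu> * C) * exp (\<gamma> * t)
        + \<gamma> * (\<sigma>^2 - 2 * r)
            * (\<sigma> * (\<gamma> * \<sigma> * t + 2 * sqrt 2 * (1 + 2 * C)) - 2 * r * \<gamma> * t) * t
        + 4 * \<gamma>^2 * L^2) / (8 * \<gamma> * \<sigma>^2)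
      + (\<gamma> * (1/2 - r / \<sigma>^2) * t + (1 + 2 * C) / (sqrt 2 * \<sigma>)) * L
    = (\<kappa> * \<sigma> - 4 * sqrt 2 * \<gamma> * \<mu> * C) / (8 * \<gamma>) * exp (\<gamma> * t)
      + \<gamma> / (2 * \<sigma>\<^sup>2) * (L - (r - \<sigma>\<^sup>2 / 2) * t)\<^sup>2
      + (1 + 2 * C) / (sqrt 2 * \<sigma>) * (L - (r - \<sigma>\<^sup>2 / 2) * t)"
proof -
  \<comment> \<open>Naming \<open>d\<close> removes the square root and makes both sides rational functions.\<close>
  define d where "d = (1 + 2 * C) / (sqrt 2 * \<sigma>)"
  have d: "2 * sqrt 2 * (1 + 2 * C) = 4 * \<sigma> * d"
    using \<open>\<sigma> \<noteq> 0\<close> by (simp add: d_def field_simps)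
  define a where "a = \<kappa> * \<sigma> - 4 * sqrt 2 * \<gamma> * \<mu> * C"
  show ?thesis
    unfolding d d_def[symmetric] a_def[symmetric] using assms
    by (simp add: field_simps power2_eq_square)
qed

text \<open>
  With \<open>a\<close>, \<open>d\<close> the coefficients of the completed square and \<open>T = e\<^sup>\<gamma>\<^sup>t\<close>, the coefficient of \<open>T\<close> is where
  \<open>C\<close> disappears: \<open>d \<sigma> \<mu>/2\<close> contributes
  \<open>\<surd>2 \<mu> (1 + 2 C)/4\<close>, and the term \<open>-\<surd>2 \<mu> C/2\<close> of \<open>a\<close> leaves \<open>\<surd>2 \<mu>/4\<close>.
\<close>

lemma exponent_on_barrier:
  fixes \<gamma> \<sigma> \<kappa> \<mu> C l T :: real
  assumes "\<gamma> \<noteq> 0" and "\<sigma> \<noteq> 0"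
  shows "(\<kappa> * \<sigma> - 4 * sqrt 2 * \<gamma> * \<mu> * C) / (8 * \<gamma>) * T
      + \<gamma> / (2 * \<sigma>\<^sup>2) * (l + \<sigma> * \<mu> * T / 2)\<^sup>2
      + (1 + 2 * C) / (sqrt 2 * \<sigma>) * (l + \<sigma> * \<mu> * T / 2)
    = 1/8 * (\<gamma> * \<mu>^2 * T\<^sup>2 + T * (2 * sqrt 2 * \<gamma> * \<mu> + \<kappa> * \<sigma>) / \<gamma> + 4 * \<gamma> * l^2 / \<sigma>^2)
      + (\<gamma> * \<mu> * T + sqrt 2 * (1 + 2 * C)) / (2 * \<sigma>) * l"
proof -
  have d: "(1 + 2 * C) / (sqrt 2 * \<sigma>) = sqrt 2 * (1 + 2 * C) / (2 * \<sigma>)"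
    using \<open>\<sigma> \<noteq> 0\<close> by (simp add: field_simps)
  show ?thesis
    unfolding d using assms by (simp add: field_simps power2_eq_square)
qed

theorem mainTheorem4:
  fixes \<alpha> \<beta> \<gamma> \<delta> r \<sigma> \<kappa> \<mu> C A \<Delta>2 :: real
    and f H R :: "real \<Rightarrow> real"
    and E u :: "real \<Rightarrow> real \<Rightarrow> real"
  assumes "\<beta> > 0" and "\<gamma> \<noteq> 0" and "\<sigma> \<noteq> 0" and "A > 0"
    and \<Delta>2: "\<Delta>2 = exp ((\<gamma> * (2 - 4 * \<delta>) + (1 + 2 * C)^2 - 4 * \<gamma> * ln \<beta>) / (4 * \<gamma>))"
    and f: "\<And>\<zeta>. f \<zeta> = - (\<gamma> / \<beta>) * (\<alpha> + \<beta> * \<zeta>) * (\<delta> + ln \<bar>\<alpha> + \<beta> * \<zeta>\<bar>)"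
    and E: "\<And>x t. E x t =
      (\<sigma>^2 * (\<kappa> * \<sigma> - 4 * sqrt 2 * \<gamma> * \<mu> * C) * exp (\<gamma> * t)
        + \<gamma> * (\<sigma>^2 - 2 * r)
            * (\<sigma> * (\<gamma> * \<sigma> * t + 2 * sqrt 2 * (1 + 2 * C)) - 2 * r * \<gamma> * t) * t
        + 4 * \<gamma>^2 * (ln \<bar>x\<bar>)^2) / (8 * \<gamma> * \<sigma>^2)"
    and u: "\<And>x t. u x t =
      \<Delta>2 * exp (E x t)
        * \<bar>x\<bar> powr (\<gamma> * (1/2 - r / \<sigma>^2) * t + (1 + 2 * C) / (sqrt 2 * \<sigma>))
      - \<alpha> / \<beta>"
    and H: "\<And>t. H t = A * exp (1/2 * (2 * r - \<sigma>^2) * t + 1/2 * \<sigma> * \<mu> * exp (\<gamma> * t))"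
    and R: "\<And>t. R t =
      \<Delta>2 * exp (1/8 * (\<gamma> * \<mu>^2 * exp (2 * \<gamma> * t)
                        + exp (\<gamma> * t) * (2 * sqrt 2 * \<gamma> * \<mu> + \<kappa> * \<sigma>) / \<gamma>
                        + 4 * \<gamma> * (ln \<bar>A\<bar>)^2 / \<sigma>^2))
        * A powr ((\<gamma> * \<mu> * exp (\<gamma> * t) + sqrt 2 * (1 + 2 * C)) / (2 * \<sigma>))
      - \<alpha> / \<beta>"
  shows "is_solution_on \<sigma> r f {(x, t). x \<noteq> 0} u \<and> satisfies_barrier_condition H R u"
proof
  define d where "d = (1 + 2 * C) / (sqrt 2 * \<sigma>)"
  define G where "G y t = (\<kappa> * \<sigma> - 4 * sqrt 2 * \<gamma> * \<mu> * C) / (8 * \<gamma>) * exp (\<gamma> * t)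
    + \<gamma> / (2 * \<sigma>\<^sup>2) * y\<^sup>2 + d * y" for y t
  have "\<Delta>2 > 0"
    by (simp add: \<Delta>2)
  have u_G: "u x t = \<Delta>2 * exp (G (ln \<bar>x\<bar> - (r - \<sigma>\<^sup>2 / 2) * t) t) - \<alpha> / \<beta>" if "x \<noteq> 0" for x t
  proof -
    have "u x t = \<Delta>2 * exp (E x t
        + (\<gamma> * (1/2 - r / \<sigma>^2) * t + (1 + 2 * C) / (sqrt 2 * \<sigma>)) * ln \<bar>x\<bar>) - \<alpha> / \<beta>"
      using that by (simp add: u powr_def exp_add)
    then show ?thesis
      unfolding E exponent_completed_square[OF \<open>\<gamma> \<noteq> 0\<close> \<open>\<sigma> \<noteq> 0\<close>] G_def d_def .
  qed

  show "is_solution_on \<sigma> r f {(x, t). x \<noteq> 0} u"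
  proof (rule is_solution_on_gaussian[where f = f and u = u and G = G,
        OF \<open>\<beta> > 0\<close> \<open>\<gamma> \<noteq> 0\<close> \<open>\<sigma> \<noteq> 0\<close> \<open>\<Delta>2 > 0\<close> _ f G_def u_G])
    have "(1 + 2 * C)\<^sup>2 = 2 * \<sigma>\<^sup>2 * d\<^sup>2"
      using \<open>\<sigma> \<noteq> 0\<close> by (simp add: d_def power_divide power_mult_distrib)
    moreover have "ln (\<beta> * \<Delta>2) = ln \<beta> + (\<gamma> * (2 - 4 * \<delta>) + (1 + 2 * C)^2 - 4 * \<gamma> * ln \<beta>) / (4 * \<gamma>)"
      using \<open>\<beta> > 0\<close> by (simp add: \<Delta>2 ln_mult)
    ultimately show "\<delta> + ln (\<beta> * \<Delta>2) = 1 / 2 + \<sigma>\<^sup>2 * d\<^sup>2 / (2 * \<gamma>)"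
      using \<open>\<gamma> \<noteq> 0\<close> by (simp add: field_simps)
  qed

  show "satisfies_barrier_condition H R u"
    unfolding satisfies_barrier_condition_def
  proof
    fix t
    have "H t > 0"
      using \<open>A > 0\<close> by (simp add: H)
    have y: "ln \<bar>H t\<bar> - (r - \<sigma>\<^sup>2 / 2) * t = ln A + \<sigma> * \<mu> * exp (\<gamma> * t) / 2"
      using \<open>A > 0\<close> by (simp add: H abs_mult ln_mult field_simps)
    have exp_sq: "exp (2 * \<gamma> * t) = (exp (\<gamma> * t))\<^sup>2"
      by (simp add: exp_double[symmetric] mult.assoc)
    have "u (H t) t = \<Delta>2 * exp (G (ln A + \<sigma> * \<mu> * exp (\<gamma> * t) / 2) t) - \<alpha> / \<beta>"
      using u_G[of "H t" t] \<open>H t > 0\<close> unfolding y by simp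
    also have "\<dots> = R t"
      unfolding G_def d_def exponent_on_barrier[OF \<open>\<gamma> \<noteq> 0\<close> \<open>\<sigma> \<noteq> 0\<close>] R exp_sq
      using \<open>A > 0\<close> by (simp add: powr_def exp_add)
    finally show "u (H t) t = R t" .
  qed
qed

end
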